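(* Let $D\ge1$. For all $i\in\{1,\ldots,D\}$ and every word $w\in W$ of length $n$, $$\Delta(Y_w^i)=\sum_{k=1}^n\ \sum_{1\le\alpha_1,\ldots,\alpha_k\le D}\ \sum_{\substack{w_1,\ldots,w_k\in W\\ w_1\cdots w_k=w}}Y_{w_1}^{\alpha_1}\cdots Y_{w_k}^{\alpha_k}\otimes Y^i_{\alpha_1\cdots\alpha_k}.$$
   Context: $K$ is a field of characteristic zero, $D\ge1$ is an integer, and $W$ is the set of non-empty words in the letters $\{1,\ldots,D\}$; $w_1\cdots w_k$ denotes concatenation. Let $\mathcal{D}=\{1,\ldots,D\}^3$, with elements written $i,(u_1,u_2)$. $\mathcal{H}_{NCK}^{\mathcal{D}}$ is, as an algebra, the free associative unital $K$-algebra generated by planar rooted trees whose vertices are decorated by elements of $\mathcal{D}$; a basis is given by planar decorated forests (words in such trees). For each $i,(u_1,u_2)\in\mathcal{D}$, $B^+_{i,(u_1,u_2)}$ is the linear endomorphism sending a forest $F$ to the tree obtained by grafting all the trees of $F$ (in order) on a common new root decorated by $i,(u_1,u_2)$. The coproduct $\Delta$ is the unique algebra morphism such that $\Delta(B^+_d(x))=B^+_d(x)\otimes1+(\mathrm{Id}\otimes B^+_d)\circ\Delta(x)$ for all $d\in\mathcal{D}$ and all $x$ (equivalently given by admissible cuts); $\mathcal{H}_{NCK}^{\mathcal{D}}$ is a Hopf algebra, graded by the number of vertices. For $i\in\{1,\ldots,D\}$ and $w\in W$ of length $n$, the element $Y_w^i\in\mathcal{H}^{\mathcal{D}}_{NCK}$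 is defined inductively on $n$ by: $Y_w^i=\delta_{i,w}$ if $n=1$, and $$Y_w^i=\sum_{1\le\alpha,\beta\le D}\ \sum_{\substack{w_1,w_2\in W\\ w_1w_2=w}}B^+_{i,(\alpha,\beta)}\left(Y_{w_1}^\alpha Y_{w_2}^\beta\right)\quad\text{if }n\ge2.$$ *)

theory Defs
  imports Complex_Main "HOL-Library.Poly_Mapping" "HOL-Library.Product_Plus"
begin

datatype 'd tree = Node 'd "'d tree list"

type_synonym 'd forest = "'d tree list"

text \<open>
  Lists form the free monoid, written additively because the convolution product on
  \<open>'a \<Rightarrow>\<^sub>0 'k\<close> is induced by a \<^class>\<open>monoid_add\<close> structure on the basis.
\<close>

instantiation list :: (type) monoid_add
begin

definition zero_list :: "'a list" where "zero_list = []"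
definition plus_list :: "'a list \<Rightarrow> 'a list \<Rightarrow> 'a list" where "plus_list = (@)"

instance by standard (simp_all add: zero_list_def plus_list_def)

end

text \<open>
  The free module on forests, with the convolution product, is the free associative unital
  algebra on the planar trees with vertices decorated by \<open>'d\<close>.  The free module on
  pairs of forests, with the product induced by the componentwise monoid structure on pairs,
  is its tensor square: the pair \<open>(F, G)\<close> stands for the pure tensor of \<open>F\<close> and \<open>G\<close>.
\<close>

type_synonym ('d, 'k) nck = "'d forest \<Rightarrow>\<^sub>0 'k"
type_synonym ('d, 'k) nck2 = "('d forest \<times> 'd forest) \<Rightarrow>\<^sub>0 'k"

definition scale :: "'k \<Rightarrow> ('a \<Rightarrow>\<^sub>0 'k::field) \<Rightarrow> ('a \<Rightarrow>\<^sub>0 'k)" where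
  "scale c x = Poly_Mapping.map ((*) c) x"

definition lin_ext :: "('a \<Rightarrow> ('b \<Rightarrow>\<^sub>0 'k)) \<Rightarrow> ('a \<Rightarrow>\<^sub>0 'k::field) \<Rightarrow> ('b \<Rightarrow>\<^sub>0 'k)" where
  "lin_ext f x = (\<Sum>a\<in>Poly_Mapping.keys x. scale (Poly_Mapping.lookup x a) (f a))"

definition tensor :: "('a \<Rightarrow>\<^sub>0 'k::field) \<Rightarrow> ('b \<Rightarrow>\<^sub>0 'k) \<Rightarrow> ('a \<times> 'b \<Rightarrow>\<^sub>0 'k)"
    (infixl \<open>\<otimes>\<close> 67) where
  "x \<otimes> y = (\<Sum>a\<in>Poly_Mapping.keys x. \<Sum>b\<in>Poly_Mapping.keys y.
     Poly_Mapping.single (a, b) (Poly_Mapping.lookup x a * Poly_Mapping.lookup y b))"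

definition tensor_map :: "(('a \<Rightarrow>\<^sub>0 'k) \<Rightarrow> ('c \<Rightarrow>\<^sub>0 'k)) \<Rightarrow> (('b \<Rightarrow>\<^sub>0 'k) \<Rightarrow> ('d \<Rightarrow>\<^sub>0 'k)) \<Rightarrow>
    ('a \<times> 'b \<Rightarrow>\<^sub>0 'k::field) \<Rightarrow> ('c \<times> 'd \<Rightarrow>\<^sub>0 'k)" where
  "tensor_map f g =
     lin_ext (\<lambda>(a, b). f (Poly_Mapping.single a 1) \<otimes> g (Poly_Mapping.single b 1))"

definition Bplus :: "'d \<Rightarrow> ('d, 'k::field) nck \<Rightarrow> ('d, 'k) nck" where
  "Bplus d = lin_ext (\<lambda>F. Poly_Mapping.single [Node d F] 1)"

definition algebra_morphism ::
    "(('a::monoid_add \<Rightarrow>\<^sub>0 'k::field) \<Rightarrow> ('b::monoid_add \<Rightarrow>\<^sub>0 'k)) \<Rightarrow> bool" where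
  "algebra_morphism \<phi> \<longleftrightarrow>
     (\<forall>x y. \<phi> (x + y) = \<phi> x + \<phi> y) \<and> (\<forall>c x. \<phi> (scale c x) = scale c (\<phi> x)) \<and>
     \<phi> 1 = 1 \<and> (\<forall>x y. \<phi> (x * y) = \<phi> x * \<phi> y)"

definition is_coproduct :: "(('d, 'k::field) nck \<Rightarrow> ('d, 'k) nck2) \<Rightarrow> bool" where
  "is_coproduct \<Delta> \<longleftrightarrow> algebra_morphism \<Delta> \<and>
     (\<forall>d x. \<Delta> (Bplus d x) = Bplus d x \<otimes> 1 + tensor_map id (Bplus d) (\<Delta> x))"

text \<open>Existence and uniqueness: \<open>ex1_coproduct\<close>.\<close>

definition coproduct :: "('d, 'k::field) nck \<Rightarrow> ('d, 'k) nck2" where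
  "coproduct = (THE \<Delta>. is_coproduct \<Delta>)"

lemma lookup_scale [simp]: "Poly_Mapping.lookup (scale c x) a = c * Poly_Mapping.lookup x a"
  by (simp add: scale_def Poly_Mapping.map.rep_eq when_def)

lemma scale_simps [simp]:
  "scale c (0::'a \<Rightarrow>\<^sub>0 'k::field) = 0" "scale 0 x = (0::'a \<Rightarrow>\<^sub>0 'k)" "scale 1 x = x"
  "scale c (scale e x) = scale (c * e) x"
  "scale c (Poly_Mapping.single a e) = Poly_Mapping.single a (c * e)"
  by (rule poly_mapping_eqI; simp add: lookup_single when_def mult.assoc)+

lemma scale_distribs:
  "scale c (x + y) = scale c x + scale c y" "scale (c + e) x = scale c x + scale e x"
  by (rule poly_mapping_eqI; simp add: lookup_add algebra_simps)+

lemma scale_sum: "scale c (sum f A) = (\<Sum>a\<in>A. scale c (f a))"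
  by (rule poly_mapping_eqI) (simp add: lookup_sum sum_distrib_left)

lemma scale_eq_mult: "scale c x = Poly_Mapping.single 0 c * x"
  for x :: "'a::monoid_add \<Rightarrow>\<^sub>0 'k::field"
  by (simp add: scale_def mult_map_scale_conv_mult)

lemma single_eq_scale: "Poly_Mapping.single a c = scale c (Poly_Mapping.single a 1)"
  by simp

lemma free_sum: "(x :: 'a \<Rightarrow>\<^sub>0 'k::field) = (\<Sum>a\<in>Poly_Mapping.keys x. Poly_Mapping.single a (Poly_Mapping.lookup x a))"
  by (rule poly_mapping_eqI)
     (auto simp: lookup_sum lookup_single when_def in_keys_iff sum.delta)

lemma free_induct [case_names zero single add]:
  assumes "P 0" "\<And>a c. P (Poly_Mapping.single a c)" "\<And>x y. P x \<Longrightarrow> P y \<Longrightarrow> P (x + y)"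
  shows "P (x :: 'a \<Rightarrow>\<^sub>0 'k::field)"
proof -
  have "P (\<Sum>a\<in>A. Poly_Mapping.single a (Poly_Mapping.lookup x a))" if "finite A" for A
    using that by (induction A rule: finite_induct) (auto intro: assms)
  from this[of "Poly_Mapping.keys x"] show ?thesis using free_sum[of x] by simp
qed

lemma lin_ext_superset:
  assumes "finite A" "Poly_Mapping.keys x \<subseteq> A"
  shows "lin_ext f x = (\<Sum>a\<in>A. scale (Poly_Mapping.lookup x a) (f a))"
  unfolding lin_ext_def using assms
  by (intro sum.mono_neutral_left) (auto simp: in_keys_iff)

lemma lin_ext_zero [simp]: "lin_ext f 0 = 0"
  by (simp add: lin_ext_def)

lemma lin_ext_add: "lin_ext f (x + y) = lin_ext f x + lin_ext f y"
proof -
  let ?A = "Poly_Mapping.keys x \<union> Poly_Mapping.keys y"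
  have "Poly_Mapping.keys (x + y) \<subseteq> ?A" by (rule keys_add)
  then show ?thesis
    by (simp add: lin_ext_superset[of ?A] lookup_add scale_distribs sum.distrib)
qed

lemma lin_ext_single [simp]: "lin_ext f (Poly_Mapping.single a c) = scale c (f a)"
  by (simp add: lin_ext_superset[of "{a}"])

lemma lin_ext_scale: "lin_ext f (scale c x) = scale c (lin_ext f x)"
  by (induction x rule: free_induct) (simp_all add: lin_ext_add scale_distribs)

lemma lin_ext_mult:
  fixes f :: "'a::monoid_add \<Rightarrow> ('b::monoid_add \<Rightarrow>\<^sub>0 'k::field)"
  assumes "\<And>a b. f (a + b) = f a * f b"
  shows "lin_ext f (x * y) = lin_ext f x * lin_ext f y"
proof (induction x rule: free_induct)
  case (single a c)
  show ?case
  proof (induction y rule: free_induct)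
    case (single b e)
    have central: "v * Poly_Mapping.single 0 e = Poly_Mapping.single 0 e * v"
      for v :: "'b \<Rightarrow>\<^sub>0 'k"
      by (induction v rule: free_induct) (simp_all add: mult_single algebra_simps)
    have "scale c (f a) * scale e (f b) = Poly_Mapping.single 0 c *
        (f a * Poly_Mapping.single 0 e) * f b"
      by (simp add: scale_eq_mult mult.assoc)
    also have "\<dots> = scale c (scale e (f a * f b))"
      unfolding central by (simp add: scale_eq_mult mult.assoc del: scale_simps)
    finally show ?case by (simp add: mult_single assms)
  qed (simp_all add: lin_ext_add algebra_simps)
qed (simp_all add: lin_ext_add algebra_simps)

lemma tensor_superset:
  assumes "finite A" "Poly_Mapping.keys x \<subseteq> A" "finite B" "Poly_Mapping.keys y \<subseteq> B"
  shows "x \<otimes> y = (\<Sum>a\<in>A. \<Sum>b\<in>B.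
     Poly_Mapping.single (a, b) (Poly_Mapping.lookup x a * Poly_Mapping.lookup y b))"
proof -
  have "x \<otimes> y = (\<Sum>a\<in>Poly_Mapping.keys x. \<Sum>b\<in>B.
     Poly_Mapping.single (a, b) (Poly_Mapping.lookup x a * Poly_Mapping.lookup y b))"
    unfolding tensor_def using assms
    by (intro sum.cong sum.mono_neutral_left) (auto simp: in_keys_iff)
  also have "\<dots> = (\<Sum>a\<in>A. \<Sum>b\<in>B.
     Poly_Mapping.single (a, b) (Poly_Mapping.lookup x a * Poly_Mapping.lookup y b))"
    using assms by (intro sum.mono_neutral_left) (auto simp: in_keys_iff)
  finally show ?thesis .
qed

lemma lookup_tensor [simp]:
  "Poly_Mapping.lookup (x \<otimes> y) (a, b) = Poly_Mapping.lookup x a * Poly_Mapping.lookup y b"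
proof -
  let ?A = "insert a (Poly_Mapping.keys x)" and ?B = "insert b (Poly_Mapping.keys y)"
  have "Poly_Mapping.lookup (x \<otimes> y) (a, b) = (\<Sum>a'\<in>?A. \<Sum>b'\<in>?B.
      if b' = b then (if a' = a then Poly_Mapping.lookup x a * Poly_Mapping.lookup y b else 0) else 0)"
    by (subst tensor_superset[of ?A _ ?B])
       (auto simp only: lookup_sum lookup_single when_def prod.inject finite_insert finite_keys
          simp_thms if_True if_False intro!: sum.cong split: if_split)
  also have "\<dots> = Poly_Mapping.lookup x a * Poly_Mapping.lookup y b"
    by (simp only: sum.delta finite_insert finite_keys) simp
  finally show ?thesis .
qed

lemma tensor_single [simp]:
  "Poly_Mapping.single a c \<otimes> Poly_Mapping.single b e = Poly_Mapping.single (a, b) (c * e)"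
  by (rule poly_mapping_eqI) (auto simp: lookup_single when_def split: prod.splits if_splits)

lemma tensor_bilinear:
  "(x + y) \<otimes> z = x \<otimes> z + y \<otimes> z" "z \<otimes> (x + y) = z \<otimes> x + z \<otimes> y"
  "scale c x \<otimes> z = scale c (x \<otimes> z)" "z \<otimes> scale c x = scale c (z \<otimes> x)"
  "0 \<otimes> z = 0" "z \<otimes> 0 = 0"
  by (rule poly_mapping_eqI; clarsimp simp: lookup_add algebra_simps)+

lemma tensor_mult: "(x \<otimes> y) * (x' \<otimes> y') = (x * x') \<otimes> (y * y')"
  for x x' :: "'a::monoid_add \<Rightarrow>\<^sub>0 'k::field" and y y' :: "'b::monoid_add \<Rightarrow>\<^sub>0 'k"
proof (induction x rule: free_induct)
  case (single a c)
  show ?case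
  proof (induction x' rule: free_induct)
    case (single a' c')
    show ?case
    proof (induction y rule: free_induct)
      case (single b e)
      show ?case
        by (induction y' rule: free_induct)
           (simp_all add: tensor_bilinear algebra_simps mult_single)
    qed (simp_all add: tensor_bilinear algebra_simps)
  qed (simp_all add: tensor_bilinear algebra_simps)
qed (simp_all add: tensor_bilinear algebra_simps)

lemma tensor_map_tensor:
  assumes "\<And>x y. f (x + y) = f x + f y" "\<And>c x. f (scale c x) = scale c (f x)"
    and "\<And>x y. g (x + y) = g x + g y" "\<And>c x. g (scale c x) = scale c (g x)"
  shows "tensor_map f g (x \<otimes> y) = f x \<otimes> g y"
proof -
  have zero: "f 0 = 0" "g 0 = 0" using assms(2,4)[of 0 0] by simp_all
  show ?thesis
  proof (induction x rule: free_induct)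
    case (single a c)
    show ?case
    proof (induction y rule: free_induct)
      case (single b e)
      have "f (Poly_Mapping.single a c) \<otimes> g (Poly_Mapping.single b e) =
          scale (c * e) (f (Poly_Mapping.single a 1) \<otimes> g (Poly_Mapping.single b 1))"
        by (subst (1 2) single_eq_scale)
           (simp only: assms tensor_bilinear scale_simps(4) mult.commute)
      then show ?case by (simp add: tensor_map_def)
    qed (simp_all add: tensor_bilinear zero assms tensor_map_def lin_ext_add)
  qed (simp_all add: tensor_bilinear zero assms tensor_map_def lin_ext_add)
qed

lemma Bplus_linear:
  "Bplus d (x + y) = Bplus d x + Bplus d y" "Bplus d (scale c x) = scale c (Bplus d x)"
  "Bplus d 0 = 0"
  by (simp_all add: Bplus_def lin_ext_add lin_ext_scale)

lemma Bplus_single [simp]: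
  "Bplus d (Poly_Mapping.single F c) = Poly_Mapping.single [Node d F] c"
  by (simp add: Bplus_def)

fun coproduct_tree :: "'d tree \<Rightarrow> ('d, 'k::field) nck2" where
  "coproduct_tree (Node d F) = Poly_Mapping.single ([Node d F], []) 1 +
     tensor_map id (Bplus d) (prod_list (map coproduct_tree F))"

lemma one_forest: "(1 :: ('d, 'k::field) nck) = Poly_Mapping.single [] 1"
  by (simp add: zero_list_def flip: single_one)

lemma single_Cons:
  "Poly_Mapping.single (t # F) (1::'k::field) = Poly_Mapping.single [t] 1 * Poly_Mapping.single F 1"
  by (simp add: mult_single plus_list_def)

lemma is_coproduct_exists:
  "is_coproduct (lin_ext (\<lambda>F. prod_list (map coproduct_tree F)) :: ('d, 'k::field) nck \<Rightarrow> _)"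
    (is "is_coproduct ?\<Delta>")
proof -
  have "?\<Delta> (Bplus d x) = Bplus d x \<otimes> 1 + tensor_map id (Bplus d) (?\<Delta> x)" for d x
    by (induction x rule: free_induct)
       (simp_all add: Bplus_linear lin_ext_add tensor_bilinear tensor_map_def lin_ext_scale
          scale_distribs one_forest)
  moreover have "?\<Delta> 1 = 1" by (simp add: one_forest)
  moreover have "?\<Delta> (x * y) = ?\<Delta> x * ?\<Delta> y" for x y
    by (rule lin_ext_mult) (simp add: plus_list_def)
  ultimately show ?thesis
    by (simp add: is_coproduct_def algebra_morphism_def lin_ext_add lin_ext_scale)
qed

lemma is_coproduct_unique:
  fixes \<Delta> \<Delta>' :: "('d, 'k::field) nck \<Rightarrow> ('d, 'k) nck2"
  assumes "is_coproduct \<Delta>" "is_coproduct \<Delta>'"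
  shows "\<Delta> = \<Delta>'"
proof
  note props = assms[unfolded is_coproduct_def algebra_morphism_def]
  have forest: "\<Delta> (Poly_Mapping.single F 1) = \<Delta>' (Poly_Mapping.single F 1)"
    if "\<And>t. t \<in> set F \<Longrightarrow> \<Delta> (Poly_Mapping.single [t] 1) = \<Delta>' (Poly_Mapping.single [t] 1)" for F
    using that
  proof (induction F)
    case Nil
    show ?case using props by (simp flip: one_forest)
  next
    case (Cons t F)
    then show ?case using props by (subst (1 2) single_Cons) simp
  qed
  have tree: "\<Delta> (Poly_Mapping.single [t] 1) = \<Delta>' (Poly_Mapping.single [t] 1)" for t
  proof (induction t)
    case (Node d F)
    have "\<Delta> (Bplus d (Poly_Mapping.single F 1)) = \<Delta>' (Bplus d (Poly_Mapping.single F 1))"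
      using props forest[OF Node] by (simp del: Bplus_single)
    then show ?case by simp
  qed
  show "\<Delta> x = \<Delta>' x" for x
  proof (induction x rule: free_induct)
    case zero
    have "\<Delta> (scale 0 0) = scale 0 (\<Delta> 0)" "\<Delta>' (scale 0 0) = scale 0 (\<Delta>' 0)" using props by blast+
    then show ?case by simp
  next
    case (single F c)
    show ?case using props forest[OF tree] by (subst (1 2) single_eq_scale) metis
  qed (use props in simp)
qed

lemma ex1_coproduct: "\<exists>!\<Delta> :: ('d, 'k::field) nck \<Rightarrow> ('d, 'k) nck2. is_coproduct \<Delta>"
  using is_coproduct_exists is_coproduct_unique by blast

lemma is_coproduct_coproduct: "is_coproduct coproduct"
  unfolding coproduct_def by (rule theI'[OF ex1_coproduct])

text \<open>
  Letters range over an arbitrary finite type \<open>'n\<close> with \<open>CARD('n) = D\<close>, so that decorations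
  range over \<open>'n \<times> ('n \<times> 'n)\<close>.  The value at the empty word is irrelevant.
\<close>

function Y :: "'n::finite \<Rightarrow> 'n list \<Rightarrow> ('n \<times> ('n \<times> 'n), 'k::field_char_0) nck" where
  "Y i [] = 0"
| "Y i [j] = (if i = j then 1 else 0)"
| "Y i (j # l # w) = (\<Sum>\<alpha>\<in>UNIV. \<Sum>\<beta>\<in>UNIV.
     \<Sum>(w1, w2)\<in>{(w1, w2). w1 \<noteq> [] \<and> w2 \<noteq> [] \<and> w1 @ w2 = j # l # w}.
       Bplus (i, (\<alpha>, \<beta>)) (Y \<alpha> w1 * Y \<beta> w2))"
  by pat_completeness auto
termination
proof (relation "measure (\<lambda>(i, w). length w)", goal_cases)
  case (2 i j l w \<alpha> \<beta> p w1 w2)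
  then have "w1 @ w2 = j # l # w" "w2 \<noteq> []" by auto
  from this(1)[THEN arg_cong, of length] this(2) show ?case by (cases w2) auto
next
  case (3 i j l w \<alpha> \<beta> p w1 w2)
  then have "w1 @ w2 = j # l # w" "w1 \<noteq> []" by auto
  from this(1)[THEN arg_cong, of length] this(2) show ?case by (cases w1) auto
qed simp

text \<open>
  The index sets over which words are factorised are finite, so no sum over them is 0 merely
  by the convention for infinite sets.
\<close>

lemma finite_factorisations:
  "finite {ws :: 'a list list. length ws = k \<and> [] \<notin> set ws \<and> concat ws = w}"
proof (rule finite_subset)
  let ?A = "{u. set u \<subseteq> set w \<and> length u \<le> length w}"
  show "finite {ws. set ws \<subseteq> ?A \<and> length ws = k}"
    by (intro finite_lists_length_eq finite_lists_length_le) simp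
  have "set u \<subseteq> set (concat ws) \<and> length u \<le> length (concat ws)"
    if "u \<in> set ws" for u and ws :: "'a list list"
    using that by (auto simp: length_concat member_le_sum_list)
  then show "{ws. length ws = k \<and> [] \<notin> set ws \<and> concat ws = w} \<subseteq> {ws. set ws \<subseteq> ?A \<and> length ws = k}"
    by fast
qed

lemma finite_splittings: "finite {(w1, w2). w1 \<noteq> [] \<and> w2 \<noteq> [] \<and> w1 @ w2 = (w :: 'a list)}"
proof (rule finite_subset)
  show "{(w1, w2). w1 \<noteq> [] \<and> w2 \<noteq> [] \<and> w1 @ w2 = w} \<subseteq> (\<lambda>k. (take k w, drop k w)) ` {..length w}"
  proof clarify
    fix w1 w2 :: "'a list" assume "w = w1 @ w2"
    then show "(w1, w2) \<in> (\<lambda>k. (take k (w1 @ w2), drop k (w1 @ w2))) ` {..length (w1 @ w2)}"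
      by (intro image_eqI[of _ _ "length w1"]) simp_all
  qed
qed simp

end

theory Submission
  imports Defs
begin

text \<open>
  The right-hand side is a sum over the ways to cut \<open>w\<close> into non-empty factors, each factor
  \<open>u\<close> carrying a letter \<open>a\<close>: such a datum is a list of pairs \<open>(a, u)\<close>, contributing
  the product of the \<open>Y a u\<close> tensor \<open>Y i\<close> of the word of labels.  The theorem is proved by
  induction on the length of \<open>w\<close>.

  A labelled factorisation of \<open>w\<close> with one factor is a letter \<open>a\<close> attached to \<open>w\<close>,
  and since \<open>Y i [a]\<close> is a Kronecker delta, these factorisations contribute \<open>Y i w \<otimes> 1\<close>.
  For a one-letter word there are no others, and both sides are the same scalar.
  If \<open>w\<close> has at least two letters, this is the first term that the cocycle equation of
  \<open>\<Delta> \<circ> B\<^sup>+\<close> produces on the recursive definition of \<open>Y i w\<close>.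

  The second term is \<open>Id \<otimes> B\<^sup>+\<close> applied to a product of two coproducts, which the
  induction hypothesis expresses by a labelled factorisation of each half of \<open>w = w1 @ w2\<close>.
  On the other side, the recursion for \<open>Y i\<close> of the word of labels cuts a labelled
  factorisation of \<open>w\<close> into two non-empty parts.  Splitting \<open>w\<close> and then factorising both
  halves is the same as factorising \<open>w\<close> and then splitting the list of factors
  (\<open>sum_splittings_factorisations\<close>), so both terms match.
\<close>

section \<open>Compatibility of the operations with sums\<close>

lemma tensor_sum_left: "sum f A \<otimes> y = (\<Sum>a\<in>A. f a \<otimes> y)"
  by (induction A rule: infinite_finite_induct) (simp_all add: tensor_bilinear)

lemma tensor_sum_right: "x \<otimes> sum f A = (\<Sum>a\<in>A. x \<otimes> f a)"
  by (induction A rule: infinite_finite_induct) (simp_all add: tensor_bilinear)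

lemma tensor_map_sum: "tensor_map f g (sum h A) = (\<Sum>a\<in>A. tensor_map f g (h a))"
  by (induction A rule: infinite_finite_induct) (simp_all add: tensor_map_def lin_ext_add)

lemma tensor_map_Bplus:
  "tensor_map id (Bplus d) (x \<otimes> y) = x \<otimes> Bplus d y"
  by (subst tensor_map_tensor) (simp_all add: Bplus_linear)

lemma tensor_one_one: "(1 :: 'a::monoid_add \<Rightarrow>\<^sub>0 'k::field) \<otimes> (1 :: 'b::monoid_add \<Rightarrow>\<^sub>0 'k) = 1"
  by (simp add: zero_prod_def flip: single_one)

lemma coproduct_morphism:
  fixes x y :: "('d, 'k::field) nck"
  shows "coproduct (x + y) = coproduct x + coproduct y"
    and "coproduct (x * y) = coproduct x * coproduct y"
    and "coproduct (1 :: ('d, 'k) nck) = 1"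
    and "coproduct (0 :: ('d, 'k) nck) = 0"
proof -
  have "is_coproduct (coproduct :: ('d, 'k) nck \<Rightarrow> _)"
    by (rule is_coproduct_coproduct)
  then have m: "algebra_morphism (coproduct :: ('d, 'k) nck \<Rightarrow> _)"
    by (simp add: is_coproduct_def)
  then show "coproduct (x + y) = coproduct x + coproduct y"
    and "coproduct (x * y) = coproduct x * coproduct y"
    and "coproduct (1 :: ('d, 'k) nck) = 1"
    by (auto simp: algebra_morphism_def)
  have "coproduct (scale 0 (0 :: ('d, 'k) nck)) = scale 0 (coproduct 0)"
    using m unfolding algebra_morphism_def by blast
  then show "coproduct (0 :: ('d, 'k) nck) = 0" by simp
qed

lemma coproduct_sum:
  "coproduct (sum f A) = (\<Sum>a\<in>A. coproduct (f a :: ('d, 'k::field) nck))"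
  by (induction A rule: infinite_finite_induct) (simp_all add: coproduct_morphism)

lemma coproduct_Bplus:
  fixes x :: "('d, 'k::field) nck"
  shows "coproduct (Bplus d x) = Bplus d x \<otimes> 1 + tensor_map id (Bplus d) (coproduct x)"
proof -
  have "is_coproduct (coproduct :: ('d, 'k) nck \<Rightarrow> _)"
    by (rule is_coproduct_coproduct)
  then show ?thesis by (simp add: is_coproduct_def)
qed

lemma sum_swap_pair:
  "(\<Sum>a\<in>A. \<Sum>b\<in>B. \<Sum>c\<in>C. f a b c) = (\<Sum>c\<in>C. \<Sum>a\<in>A. \<Sum>b\<in>B. f a b c)"
  by (subst sum.swap[of _ C B]) (rule sum.swap)

lemma sum_swap_pairs:
  "(\<Sum>a\<in>A. \<Sum>b\<in>B. \<Sum>c\<in>C. \<Sum>d\<in>D. f a b c d) = (\<Sum>c\<in>C. \<Sum>d\<in>D. \<Sum>a\<in>A. \<Sum>b\<in>B. f a b c d)"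
  by (subst sum_swap_pair) (intro sum.cong refl sum_swap_pair)

section \<open>Splittings and labelled factorisations of words\<close>

definition splittings :: "'a list \<Rightarrow> ('a list \<times> 'a list) set" where
  "splittings w = {(w1, w2). w1 \<noteq> [] \<and> w2 \<noteq> [] \<and> w1 @ w2 = w}"

text \<open>
  A factorisation and its labels are kept together as one list of pairs, so that cutting this
  list in two cuts the factors and the labels at the same place.
\<close>

definition labelled_factorisations :: "'n list \<Rightarrow> ('n \<times> 'n list) list set" where
  "labelled_factorisations w = {zs. (\<forall>z\<in>set zs. snd z \<noteq> []) \<and> concat (map snd zs) = w}"

lemma finite_set_splittings [simp]: "finite (splittings w)"
  unfolding splittings_def by (rule finite_splittings)

lemma length_factors_le:
  assumes "[] \<notin> set ws"
  shows "length ws \<le> length (concat ws)"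
  using assms
proof (induction ws)
  case (Cons u ws)
  then show ?case by (cases u) auto
qed simp

lemma length_labelled_factorisation_le:
  "zs \<in> labelled_factorisations w \<Longrightarrow> length zs \<le> length w"
  using length_factors_le[of "map snd zs"] by (force simp: labelled_factorisations_def)

lemma finite_labelled_factorisations [simp]:
  "finite (labelled_factorisations (w :: 'n::finite list))"
proof (rule finite_subset)
  let ?A = "(UNIV :: 'n set) \<times> {u :: 'n list. set u \<subseteq> UNIV \<and> length u \<le> length w}"
  show "finite {zs. set zs \<subseteq> ?A \<and> length zs \<le> length w}"
    by (intro finite_lists_length_le finite_cartesian_product) simp_all
  have "length u \<le> length w" if "zs \<in> labelled_factorisations w" "(a, u) \<in> set zs" for zs a u
  proof -
    have "length u \<in> set (map length (map snd zs))" using that(2) by force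
    then have "length u \<le> length (concat (map snd zs))"
      unfolding length_concat by (intro member_le_sum_list) simp_all
    then show ?thesis using that(1) by (simp add: labelled_factorisations_def)
  qed
  then show "labelled_factorisations w \<subseteq> {zs. set zs \<subseteq> ?A \<and> length zs \<le> length w}"
    using length_labelled_factorisation_le by auto
qed

lemma concat_factors_eq_Nil_iff:
  "\<forall>z\<in>set zs. snd z \<noteq> [] \<Longrightarrow> concat (map snd zs) = [] \<longleftrightarrow> zs = []"
  by (cases zs) simp_all

lemma labelled_factorisation_Nil_iff:
  "zs \<in> labelled_factorisations w \<Longrightarrow> zs = [] \<longleftrightarrow> w = []"
  unfolding labelled_factorisations_def using concat_factors_eq_Nil_iff[of zs] by blast

lemma one_factor:
  assumes "w \<noteq> []"
  shows "{zs \<in> labelled_factorisations w. length zs = 1} = range (\<lambda>a. [(a, w)])"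
proof (intro equalityI subsetI)
  fix zs assume "zs \<in> {zs \<in> labelled_factorisations w. length zs = 1}"
  then obtain a u where "zs = [(a, u)]" "u = w"
    by (auto simp: labelled_factorisations_def length_Suc_conv)
  then show "zs \<in> range (\<lambda>a. [(a, w)])" by simp
qed (use assms in \<open>auto simp: labelled_factorisations_def\<close>)

lemma splittings_empty:
  assumes "length w < 2"
  shows "splittings w = {}"
proof -
  have "length w \<ge> 2" if "w = w1 @ w2" "w1 \<noteq> []" "w2 \<noteq> []" for w1 w2
    using that by (cases w1; cases w2) auto
  then show ?thesis using assms by (force simp: splittings_def)
qed

lemma bij_betw_splittings_map:
  "bij_betw (map_prod (map f) (map f)) (splittings xs) (splittings (map f xs))"
  unfolding bij_betw_def
proof
  show "inj_on (map_prod (map f) (map f)) (splittings xs)"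
    by (rule inj_onI)
       (auto simp: splittings_def; metis append_eq_append_conv length_map)
  show "map_prod (map f) (map f) ` splittings xs = splittings (map f xs)"
  proof
    show "splittings (map f xs) \<subseteq> map_prod (map f) (map f) ` splittings xs"
    proof
      fix p assume "p \<in> splittings (map f xs)"
      then obtain us vs where "us @ vs = xs" "p = (map f us, map f vs)" "us \<noteq> []" "vs \<noteq> []"
        unfolding splittings_def append_eq_map_conv by blast
      then show "p \<in> map_prod (map f) (map f) ` splittings xs"
        by (intro image_eqI[of _ _ "(us, vs)"]) (simp_all add: splittings_def)
    qed
  qed (auto simp: splittings_def)
qed

text \<open>
  The combinatorial core: concatenation identifies the labelled factorisations of both halves of
  a splitting of \<open>w\<close> with the splittings of the labelled factorisations of \<open>w\<close>.  Non-empty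
  parts correspond on both sides because no factor is empty.
\<close>

lemma sum_splittings_factorisations:
  fixes f :: "('n::finite \<times> 'n list) list \<Rightarrow> ('n \<times> 'n list) list \<Rightarrow> 'c::comm_monoid_add"
  shows "(\<Sum>(w1, w2)\<in>splittings w. \<Sum>xs\<in>labelled_factorisations w1.
            \<Sum>ys\<in>labelled_factorisations w2. f xs ys) =
         (\<Sum>zs\<in>labelled_factorisations w. \<Sum>(xs, ys)\<in>splittings zs. f xs ys)"
proof -
  let ?L = "SIGMA p:splittings w. labelled_factorisations (fst p) \<times> labelled_factorisations (snd p)"
  let ?R = "SIGMA zs:labelled_factorisations w. splittings zs"
  let ?word = "\<lambda>zs :: ('n \<times> 'n list) list. concat (map snd zs)"
  have "(\<Sum>(w1, w2)\<in>splittings w. \<Sum>xs\<in>labelled_factorisations w1.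
            \<Sum>ys\<in>labelled_factorisations w2. f xs ys) = (\<Sum>(p, xs, ys)\<in>?L. f xs ys)"
    by (simp add: sum.Sigma sum.cartesian_product case_prod_unfold)
  also have "\<dots> = (\<Sum>(zs, xs, ys)\<in>?R. f xs ys)"
    by (rule sum.reindex_bij_witness
          [where i = "\<lambda>(zs, xs, ys). ((?word xs, ?word ys), xs, ys)"
             and j = "\<lambda>(p, xs, ys). (xs @ ys, xs, ys)"])
       (auto simp: splittings_def labelled_factorisations_def ball_Un concat_factors_eq_Nil_iff
          simp del: concat_eq_Nil_conv, (metis snd_conv)+)
  also have "\<dots> = (\<Sum>zs\<in>labelled_factorisations w. \<Sum>(xs, ys)\<in>splittings zs. f xs ys)"
    by (simp add: sum.Sigma case_prod_unfold)
  finally show ?thesis .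
qed

text \<open>
  Zipping the labels with the factors turns the indexing by number of factors, labels and factors
  into the indexing by lists of pairs.  The bound on the number of factors is automatic, since
  each of them takes at least one letter of \<open>w\<close>.
\<close>

lemma sum_factorisations_by_length:
  fixes g :: "'n::finite list \<Rightarrow> 'n list list \<Rightarrow> 'c::comm_monoid_add"
  assumes "w \<noteq> []"
  shows "(\<Sum>k = 1..length w. \<Sum>\<alpha>s \<in> {\<alpha>s. length \<alpha>s = k}.
       \<Sum>ws \<in> {ws. length ws = k \<and> [] \<notin> set ws \<and> concat ws = w}. g \<alpha>s ws) =
     (\<Sum>zs\<in>labelled_factorisations w. g (map fst zs) (map snd zs))"
proof -
  define A :: "nat \<Rightarrow> 'n list set" where "A k = {\<alpha>s. length \<alpha>s = k}" for k
  define B where "B k = {ws. length ws = k \<and> [] \<notin> set ws \<and> concat ws = w}" for k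
  have fin: "finite (A k)" "finite (B k)" for k
    using finite_lists_length_eq[of "UNIV :: 'n set" k]
    by (simp_all add: A_def B_def finite_factorisations)
  have "(\<Sum>k = 1..length w. \<Sum>\<alpha>s \<in> A k. \<Sum>ws \<in> B k. g \<alpha>s ws) =
      (\<Sum>(k, \<alpha>s, ws)\<in>(SIGMA k:{1..length w}. A k \<times> B k). g \<alpha>s ws)"
    by (simp add: sum.Sigma sum.cartesian_product fin)
  also have "\<dots> = (\<Sum>zs\<in>labelled_factorisations w. g (map fst zs) (map snd zs))"
  proof (rule sum.reindex_bij_witness
      [where i = "\<lambda>zs. (length zs, map fst zs, map snd zs)" and j = "\<lambda>(k, \<alpha>s, ws). zip \<alpha>s ws"])
    fix zs assume zs: "zs \<in> labelled_factorisations w"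
    then show "(length zs, map fst zs, map snd zs) \<in> (SIGMA k:{1..length w}. A k \<times> B k)"
      using assms length_labelled_factorisation_le[OF zs] labelled_factorisation_Nil_iff[OF zs]
      by (auto simp: A_def B_def labelled_factorisations_def Suc_le_eq)
  qed (auto simp: A_def B_def labelled_factorisations_def zip_map_fst_snd dest: set_zip_rightD)
  finally show ?thesis unfolding A_def B_def .
qed

section \<open>The coproduct of the elements Y\<close>

lemma Y_recursion:
  assumes "length w \<ge> 2"
  shows "Y i w = (\<Sum>\<alpha>\<in>UNIV. \<Sum>\<beta>\<in>UNIV. \<Sum>(w1, w2)\<in>splittings w.
     Bplus (i, (\<alpha>, \<beta>)) (Y \<alpha> w1 * Y \<beta> w2))"
proof -
  obtain j l v where "w = j # l # v"
    using assms by (cases w; cases "tl w") auto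
  then show ?thesis by (simp add: splittings_def)
qed

definition Y_product ::
    "('n::finite \<times> 'n list) list \<Rightarrow> ('n \<times> ('n \<times> 'n), 'k::field_char_0) nck" where
  "Y_product zs = prod_list (map (\<lambda>(a, u). Y a u) zs)"

lemma Y_product_append: "Y_product (xs @ ys) = Y_product xs * Y_product ys"
  by (simp add: Y_product_def)

lemma sum_one_factor:
  assumes "w \<noteq> []"
  shows "(\<Sum>zs\<in>{zs \<in> labelled_factorisations w. length zs = 1}.
      Y_product zs \<otimes> Y i (map fst zs)) = Y i w \<otimes> (1 :: (_, 'k::field_char_0) nck)"
proof -
  have "(\<Sum>zs\<in>{zs \<in> labelled_factorisations w. length zs = 1}.
      Y_product zs \<otimes> Y i (map fst zs)) =
      (\<Sum>a\<in>UNIV. Y a w \<otimes> (if i = a then 1 else 0 :: (_, 'k) nck))"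
    unfolding one_factor[OF assms] by (subst sum.reindex) (auto simp: inj_on_def Y_product_def)
  also have "\<dots> = (\<Sum>a\<in>UNIV. if i = a then Y a w \<otimes> 1 else 0)"
    by (intro sum.cong) (simp_all add: tensor_bilinear)
  finally show ?thesis by simp
qed

text \<open>
  The recursion of \<open>Y\<close> is applied to the word of labels and transported to the list of pairs.
  Lists with one factor have no splitting and drop out of the right-hand side, so that it can
  range over all factorisations.
\<close>

lemma sum_several_factors:
  assumes "w \<noteq> []"
  shows "(\<Sum>zs\<in>{zs \<in> labelled_factorisations w. length zs \<noteq> 1}.
      Y_product zs \<otimes> (Y i (map fst zs) :: (_, 'k::field_char_0) nck)) =
    (\<Sum>zs\<in>labelled_factorisations w. \<Sum>(xs, ys)\<in>splittings zs. \<Sum>\<alpha>\<in>UNIV. \<Sum>\<beta>\<in>UNIV.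
      (Y_product xs * Y_product ys) \<otimes>
        Bplus (i, (\<alpha>, \<beta>)) (Y \<alpha> (map fst xs) * Y \<beta> (map fst ys)))"
    (is "_ = sum ?h _")
proof -
  have "Y_product zs \<otimes> (Y i (map fst zs) :: (_, 'k) nck) = ?h zs"
    if "zs \<in> labelled_factorisations w" "length zs \<noteq> 1" for zs
  proof -
    have "length zs \<ge> 2"
      using that labelled_factorisation_Nil_iff[OF that(1)] assms
      by (cases zs; cases "tl zs") auto
    then have "(Y i (map fst zs) :: (_, 'k) nck) =
        (\<Sum>\<alpha>\<in>UNIV. \<Sum>\<beta>\<in>UNIV. \<Sum>(v1, v2)\<in>splittings (map fst zs).
          Bplus (i, (\<alpha>, \<beta>)) (Y \<alpha> v1 * Y \<beta> v2))"
      by (simp add: Y_recursion)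
    also have "\<dots> = (\<Sum>\<alpha>\<in>UNIV. \<Sum>\<beta>\<in>UNIV. \<Sum>(xs, ys)\<in>splittings zs.
          Bplus (i, (\<alpha>, \<beta>)) (Y \<alpha> (map fst xs) * Y \<beta> (map fst ys)))"
      by (simp add: sum.reindex_bij_betw[OF bij_betw_splittings_map, symmetric]
          case_prod_unfold)
    also have "\<dots> = (\<Sum>(xs, ys)\<in>splittings zs. \<Sum>\<alpha>\<in>UNIV. \<Sum>\<beta>\<in>UNIV.
          Bplus (i, (\<alpha>, \<beta>)) (Y \<alpha> (map fst xs) * Y \<beta> (map fst ys)))"
      unfolding case_prod_unfold by (rule sum_swap_pair)
    finally have Y_labels: "(Y i (map fst zs) :: (_, 'k) nck) = \<dots>" .
    show ?thesis
      unfolding Y_labels tensor_sum_right case_prod_unfold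
      by (intro sum.cong refl arg_cong2[where f = tensor])
         (auto simp: splittings_def Y_product_append)
  qed
  then have "(\<Sum>zs\<in>{zs \<in> labelled_factorisations w. length zs \<noteq> 1}.
      Y_product zs \<otimes> (Y i (map fst zs) :: (_, 'k) nck)) =
      sum ?h {zs \<in> labelled_factorisations w. length zs \<noteq> 1}"
    by (intro sum.cong) auto
  also have "\<dots> = sum ?h (labelled_factorisations w)"
    by (intro sum.mono_neutral_left) (auto simp: splittings_empty)
  finally show ?thesis .
qed

lemma coproduct_Y:
  assumes "w \<noteq> []"
  shows "coproduct (Y i w :: (_, 'k::field_char_0) nck) =
    (\<Sum>zs\<in>labelled_factorisations w. Y_product zs \<otimes> Y i (map fst zs))"
  using assms
proof (induction "length w" arbitrary: i w rule: less_induct)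
  case less
  let ?tail = "\<Sum>zs\<in>labelled_factorisations w. \<Sum>(xs, ys)\<in>splittings zs. \<Sum>\<alpha>\<in>UNIV. \<Sum>\<beta>\<in>UNIV.
      (Y_product xs * Y_product ys) \<otimes>
        Bplus (i, (\<alpha>, \<beta>)) (Y \<alpha> (map fst xs) * Y \<beta> (map fst ys) :: (_, 'k) nck)"
  have "(\<Sum>zs\<in>labelled_factorisations w. Y_product zs \<otimes> Y i (map fst zs)) =
      (\<Sum>zs\<in>{zs \<in> labelled_factorisations w. length zs = 1}. Y_product zs \<otimes> Y i (map fst zs)) +
      (\<Sum>zs\<in>{zs \<in> labelled_factorisations w. length zs \<noteq> 1}.
         Y_product zs \<otimes> (Y i (map fst zs) :: (_, 'k) nck))"
    by (subst sum.union_disjoint[symmetric]) (auto intro!: sum.cong)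
  also have "\<dots> = Y i w \<otimes> 1 + ?tail"
    by (simp only: sum_one_factor[OF less.prems] sum_several_factors[OF less.prems])
  finally have rhs: "(\<Sum>zs\<in>labelled_factorisations w. Y_product zs \<otimes> Y i (map fst zs)) =
      Y i w \<otimes> 1 + ?tail" .
  have tail: "?tail = (\<Sum>(w1, w2)\<in>splittings w. \<Sum>xs\<in>labelled_factorisations w1.
      \<Sum>ys\<in>labelled_factorisations w2. \<Sum>\<alpha>\<in>UNIV. \<Sum>\<beta>\<in>UNIV. (Y_product xs * Y_product ys) \<otimes>
        Bplus (i, (\<alpha>, \<beta>)) (Y \<alpha> (map fst xs) * Y \<beta> (map fst ys)))"
    by (rule sum_splittings_factorisations[symmetric])
  show ?case
  proof (cases "length w \<ge> 2")
    case False
    then obtain j where w: "w = [j]" using less.prems by (cases w; cases "tl w") auto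
    then have "?tail = 0" unfolding tail by (simp add: splittings_empty)
    then show ?thesis
      unfolding rhs by (simp add: w coproduct_morphism tensor_one_one tensor_bilinear)
  next
    case True
    have step: "tensor_map id (Bplus (i, (\<alpha>, \<beta>))) (coproduct (Y \<alpha> w1 * Y \<beta> w2 :: (_, 'k) nck)) =
        (\<Sum>xs\<in>labelled_factorisations w1. \<Sum>ys\<in>labelled_factorisations w2.
           (Y_product xs * Y_product ys) \<otimes>
           Bplus (i, (\<alpha>, \<beta>)) (Y \<alpha> (map fst xs) * Y \<beta> (map fst ys)))"
      if "(w1, w2) \<in> splittings w" for \<alpha> \<beta> w1 w2
    proof -
      have "length w1 < length w" "length w2 < length w" "w1 \<noteq> []" "w2 \<noteq> []"
        using that by (auto simp: splittings_def)
      then show ?thesis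
        by (simp add: coproduct_morphism less.hyps sum_product tensor_mult tensor_map_sum
            tensor_map_Bplus)
    qed
    have "coproduct (Y i w :: (_, 'k) nck) =
        (\<Sum>\<alpha>\<in>UNIV. \<Sum>\<beta>\<in>UNIV. \<Sum>(w1, w2)\<in>splittings w.
          Bplus (i, (\<alpha>, \<beta>)) (Y \<alpha> w1 * Y \<beta> w2) \<otimes> 1) +
        (\<Sum>\<alpha>\<in>UNIV. \<Sum>\<beta>\<in>UNIV. \<Sum>(w1, w2)\<in>splittings w.
          tensor_map id (Bplus (i, (\<alpha>, \<beta>))) (coproduct (Y \<alpha> w1 * Y \<beta> w2)))"
      by (simp add: Y_recursion[OF True] coproduct_sum coproduct_Bplus case_prod_unfold
          sum.distrib)
    also have "(\<Sum>\<alpha>\<in>UNIV. \<Sum>\<beta>\<in>UNIV. \<Sum>(w1, w2)\<in>splittings w.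
          Bplus (i, (\<alpha>, \<beta>)) (Y \<alpha> w1 * Y \<beta> w2 :: (_, 'k) nck) \<otimes> 1) = Y i w \<otimes> 1"
      by (simp add: Y_recursion[OF True] tensor_sum_left case_prod_unfold)
    also have "(\<Sum>\<alpha>\<in>UNIV. \<Sum>\<beta>\<in>UNIV. \<Sum>(w1, w2)\<in>splittings w.
          tensor_map id (Bplus (i, (\<alpha>, \<beta>))) (coproduct (Y \<alpha> w1 * Y \<beta> w2 :: (_, 'k) nck))) =
        (\<Sum>\<alpha>\<in>UNIV. \<Sum>\<beta>\<in>UNIV. \<Sum>(w1, w2)\<in>splittings w.
          \<Sum>xs\<in>labelled_factorisations w1. \<Sum>ys\<in>labelled_factorisations w2.
           (Y_product xs * Y_product ys) \<otimes>
           Bplus (i, (\<alpha>, \<beta>)) (Y \<alpha> (map fst xs) * Y \<beta> (map fst ys)))"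
      by (intro sum.cong) (auto simp: step)
    also have "\<dots> = (\<Sum>(w1, w2)\<in>splittings w. \<Sum>\<alpha>\<in>UNIV. \<Sum>\<beta>\<in>UNIV.
          \<Sum>xs\<in>labelled_factorisations w1. \<Sum>ys\<in>labelled_factorisations w2.
           (Y_product xs * Y_product ys) \<otimes>
           Bplus (i, (\<alpha>, \<beta>)) (Y \<alpha> (map fst xs) * Y \<beta> (map fst ys)))"
      unfolding case_prod_unfold by (rule sum_swap_pair)
    also have "\<dots> = ?tail"
      unfolding tail
      by (rule sum.cong[OF refl]) (simp only: case_prod_unfold, rule sum_swap_pairs)
    finally show ?thesis unfolding rhs .
  qed
qed

theorem theorem21:
  fixes i :: "'n::finite" and w :: "'n list"
  assumes "w \<noteq> []"
  shows "coproduct (Y i w :: ('n \<times> ('n \<times> 'n), 'k::field_char_0) nck) =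
    (\<Sum>k = 1..length w. \<Sum>\<alpha>s \<in> {\<alpha>s. length \<alpha>s = k}.
       \<Sum>ws \<in> {ws. length ws = k \<and> [] \<notin> set ws \<and> concat ws = w}.
         prod_list (map2 Y \<alpha>s ws) \<otimes> Y i \<alpha>s)"
  unfolding sum_factorisations_by_length[OF assms]
  by (simp add: coproduct_Y[OF assms] Y_product_def zip_map_fst_snd)

end
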